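(* Let $I=[a,b]\subset\mathbb{R}$, let $m$ be a nonnegative integer, let $f\in C^{(m+1)}(I)$ and let $P,f:I\to\mathbb{R}$ be integrable functions. Then $$\int_a^b f(y)P(y)\,dy=\sum_{i=0}^{m}\left(\int_a^b P(y)\frac{(b-y)^i}{i!}\,dy\right)(-1)^i f^{(i)}(b)+\int_a^b\left(\int_a^s P(y)\frac{(s-y)^m}{m!}\,dy\right)(-1)^{m+1}f^{(m+1)}(s)\,ds.$$
   Context: $C^{(m+1)}(I)$ denotes the real-valued functions on $I=[a,b]$ ($a<b$) with continuous derivatives up to order $m+1$. Convention: $(\cdot)^0=1$. *)

theory Defs
  imports "HOL-Analysis.Analysis"
begin

text \<open>
  The \<open>i\<close>-th derivative of \<open>f\<close> relative to \<open>S\<close>. Derivatives are taken within \<open>S\<close>, so on a compact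
  interval they are one-sided at the endpoints and do not depend on the values of \<open>f\<close> outside
  the interval.
\<close>
definition nth_deriv_within :: "real set \<Rightarrow> nat \<Rightarrow> (real \<Rightarrow> real) \<Rightarrow> real \<Rightarrow> real" where
  "nth_deriv_within S i f = ((\<lambda>g x. vector_derivative g (at x within S)) ^^ i) f"

definition C_k_on :: "nat \<Rightarrow> real set \<Rightarrow> (real \<Rightarrow> real) \<Rightarrow> bool" where
  "C_k_on k S f \<longleftrightarrow>
     (\<forall>i<k. nth_deriv_within S i f differentiable_on S) \<and>
     (\<forall>i\<le>k. continuous_on S (nth_deriv_within S i f))"

end

(* Expand f(y) by Taylor's formula with integral remainder about the right endpoint b, multiply
   by P(y) and integrate over y; Fubini's theorem on the triangle a <= y <= s <= b turns the
   remainder into the last integral. *)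
theory Submission
  imports Defs
begin

text \<open>The reflection t -> -t carries \<open>{a..b}\<close> to \<open>{-b..-a}\<close> and
  makes \<open>b\<close> the left endpoint, so \<open>Taylor_has_integral\<close>, which expands
  about a left endpoint, applies to t -> f(-t).\<close>

lemma Taylor_has_integral_right_endpoint:
  fixes f :: "real \<Rightarrow> 'a::banach" and a b :: real
  assumes "p > 0"
    and f0: "Df 0 = f"
    and Df: "\<And>m t. m < p \<Longrightarrow> a \<le> t \<Longrightarrow> t \<le> b \<Longrightarrow>
      (Df m has_vector_derivative Df (Suc m) t) (at t within {a..b})"
    and "a \<le> b"
  shows "((\<lambda>x. ((x - a) ^ (p - 1) / fact (p - 1)) *\<^sub>R ((-1) ^ p *\<^sub>R Df p x)) has_integral
    f a - (\<Sum>i<p. ((b - a) ^ i / fact i) *\<^sub>R ((-1) ^ i *\<^sub>R Df i b))) {a..b}"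
proof -
  \<comment> \<open>\<open>E i\<close> is the i-th derivative of t -> f(-t): each differentiation
    contributes one factor -1 by the chain rule.\<close>
  define E where "E = (\<lambda>i t. (-1) ^ i *\<^sub>R Df i (- t))"
  have E: "(E m has_vector_derivative E (Suc m) t) (at t within {-b..-a})"
    if "m < p" "-b \<le> t" "t \<le> -a" for m t
  proof -
    have "(Df m has_vector_derivative Df (Suc m) (- t)) (at (- t) within uminus ` {-b..-a})"
      using Df[of m "- t"] that by simp
    then have "((Df m \<circ> uminus) has_vector_derivative (-1) *\<^sub>R Df (Suc m) (- t)) (at t within {-b..-a})"
      by (intro vector_diff_chain_within) (auto intro!: derivative_eq_intros)
    then have "((\<lambda>t. (-1) ^ m *\<^sub>R (Df m \<circ> uminus) t) has_vector_derivative
        (-1) ^ m *\<^sub>R ((-1) *\<^sub>R Df (Suc m) (- t))) (at t within {-b..-a})"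
      by (rule bounded_linear.has_vector_derivative[OF bounded_linear_scaleR_right])
    then show ?thesis
      by (simp add: E_def o_def)
  qed
  have "((\<lambda>x. ((- a - x) ^ (p - 1) / fact (p - 1)) *\<^sub>R E p x) has_integral
      f (- (- a)) - (\<Sum>i<p. ((- a - - b) ^ i / fact i) *\<^sub>R E i (- b))) {- b..- a}"
    using Taylor_has_integral[of p E "\<lambda>t. f (- t)" "- b" "- a", OF \<open>p > 0\<close> _ E] \<open>a \<le> b\<close>
    by (simp add: E_def f0)
  then show ?thesis
    \<comment> \<open>Substituting -x for x returns to \<open>{a..b}\<close>: the kernel base -a - x
      becomes x - a, and \<open>E p\<close> at -x is
      \<open>(-1) ^ p *\<^sub>R Df p x\<close>.\<close>
    by (subst (asm) has_integral_reflect_real[symmetric]) (simp add: E_def)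
qed

text \<open>Completion leaves the measure of the original sets unchanged, so the same countable
  cover works. Fubini needs this because \<open>lebesgue\<close> is the completion of
  \<open>lborel\<close>.\<close>

lemma (in sigma_finite_measure) sigma_finite_measure_completion:
  "sigma_finite_measure (completion M)"
proof
  obtain A where "countable A" "A \<subseteq> sets M" "\<Union>A = space M" "\<forall>a\<in>A. emeasure M a \<noteq> \<infinity>"
    using sigma_finite_countable by auto
  then show "\<exists>A. countable A \<and> A \<subseteq> sets (completion M) \<and> \<Union>A = space (completion M)
      \<and> (\<forall>a\<in>A. emeasure (completion M) a \<noteq> \<infinity>)"
    by (intro exI[of _ A]) auto
qed

text \<open>The inner integral of the absolute value is |f x| times a constant, hence integrable in
  x.\<close>

lemma (in pair_sigma_finite) integrable_mult_product:
  fixes f :: "'a \<Rightarrow> real" and g :: "'b \<Rightarrow> real"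
  assumes f: "integrable M1 f" and g: "integrable M2 g"
  shows "integrable (M1 \<Otimes>\<^sub>M M2) (\<lambda>(x, y). f x * g y)"
proof (rule Fubini_integrable)
  show "(\<lambda>(x, y). f x * g y) \<in> borel_measurable (M1 \<Otimes>\<^sub>M M2)"
    using borel_measurable_integrable[OF f] borel_measurable_integrable[OF g] by measurable
qed (use f g in \<open>simp_all add: abs_mult\<close>)

text \<open>Both sides are iterated integrals of one function \<open>H\<close>, the integrand
  extended by zero off the triangle a <= y <= s <= b. It is dominated by a multiple of the product
  of two integrable functions, so Fubini applies. The first conclusion allows splitting off the
  remainder from a sum under the integral.\<close>

lemma set_integral_triangle_swap:
  fixes P g :: "real \<Rightarrow> real" and k :: "real \<Rightarrow> real \<Rightarrow> real"
  assumes P: "P absolutely_integrable_on {a..b}" and g: "g absolutely_integrable_on {a..b}"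
    and k: "case_prod k \<in> borel_measurable borel"
    and bound: "\<And>y s. a \<le> y \<Longrightarrow> y \<le> s \<Longrightarrow> s \<le> b \<Longrightarrow> \<bar>k y s\<bar> \<le> C"
  shows "set_integrable lebesgue {a..b} (\<lambda>y. P y * (LINT s:{y..b}|lebesgue. k y s * g s))"
    and "(LINT y:{a..b}|lebesgue. P y * (LINT s:{y..b}|lebesgue. k y s * g s)) =
      (LINT s:{a..b}|lebesgue. (LINT y:{a..s}|lebesgue. P y * k y s) * g s)"
proof -
  interpret L: sigma_finite_measure "lebesgue :: real measure"
    by (rule lborel.sigma_finite_measure_completion)
  interpret LL: pair_sigma_finite "lebesgue :: real measure" "lebesgue :: real measure" ..
  let ?M = "lebesgue \<Otimes>\<^sub>M lebesgue :: (real \<times> real) measure"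
  define p where "p y = indicator {a..b} y * P y" for y
  define q where "q s = indicator {a..b} s * g s" for s
  \<comment> \<open>Cutting off at the diagonal encodes the triangle and makes the bound on
    \<open>k\<close> sufficient, as nothing is assumed about its size elsewhere.\<close>
  define K where "K = (\<lambda>(y, s). if y \<le> s then k y s else 0)"
  define H where "H y s = p y * q s * K (y, s)" for y s
  have p: "integrable lebesgue p" and q: "integrable lebesgue q"
    using P g by (simp_all add: p_def[abs_def] q_def[abs_def] set_integrable_def)
  have pq: "integrable ?M (\<lambda>(y, s). p y * q s)"
    by (rule LL.integrable_mult_product[OF p q])
  \<comment> \<open>Both coordinates are measurable from \<open>?M\<close> to the Borel sets of the
    line, so the identity is measurable from \<open>?M\<close> to the Borel sets of the plane.
    Composing with it transfers Borel measurability of \<open>K\<close> to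
    \<open>?M\<close>.\<close>
  have "fst \<in> borel_measurable ?M" "snd \<in> borel_measurable ?M"
    by (auto intro!: measurable_compose[OF measurable_fst] measurable_compose[OF measurable_snd]
        measurable_completion)
  then have "(\<lambda>z. (fst z, snd z)) \<in> borel_measurable ?M"
    by (rule borel_measurable_Pair)
  then have id: "(\<lambda>z. z) \<in> borel_measurable ?M"
    by simp
  have "K \<in> borel_measurable borel"
  proof -
    have "{z :: real \<times> real. fst z \<le> snd z} \<in> sets borel"
      by (intro borel_closed closed_Collect_le continuous_intros)
    then have "(\<lambda>z. if fst z \<le> snd z then case_prod k z else 0) \<in> borel_measurable borel"
      using k by (intro measurable_If) auto
    moreover have "K = (\<lambda>z. if fst z \<le> snd z then case_prod k z else 0)"
      by (auto simp: K_def)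
    ultimately show ?thesis
      by simp
  qed
  then have K: "K \<in> borel_measurable ?M"
    by (rule measurable_compose[OF id])
  have H: "integrable ?M (case_prod H)"
  proof (rule Bochner_Integration.integrable_bound)
    show "integrable ?M (\<lambda>z. C * (case z of (y, s) \<Rightarrow> p y * q s))"
      by (intro integrable_mult_right pq)
    show "case_prod H \<in> borel_measurable ?M"
    proof -
      have "case_prod H = (\<lambda>z. (case z of (y, s) \<Rightarrow> p y * q s) * K z)"
        by (auto simp: H_def)
      then show ?thesis
        using borel_measurable_times[OF borel_measurable_integrable[OF pq] K] by simp
    qed
    \<comment> \<open>\<open>C\<close> stands inside the absolute value because its sign is unknown
      when the triangle is empty.\<close>
    have "\<bar>H y s\<bar> \<le> \<bar>C * (p y * q s)\<bar>" for y s
    proof (cases "a \<le> y \<and> y \<le> s \<and> s \<le> b")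
      case True
      then have "\<bar>k y s\<bar> \<le> \<bar>C\<bar>"
        using bound[of y s] by linarith
      then have "\<bar>p y * q s\<bar> * \<bar>k y s\<bar> \<le> \<bar>p y * q s\<bar> * \<bar>C\<bar>"
        by (intro mult_left_mono) auto
      then show ?thesis
        using True by (simp add: H_def K_def abs_mult mult.commute)
    next
      case False
      then have "H y s = 0"
        by (auto simp: H_def K_def p_def q_def indicator_def)
      then show ?thesis
        by simp
    qed
    then show "AE z in ?M. norm (case_prod H z) \<le> norm (C * (case z of (y, s) \<Rightarrow> p y * q s))"
      by (intro AE_I2) (auto simp: case_prod_beta)
  qed
  \<comment> \<open>For fixed y in \<open>{a..b}\<close> the cutoffs leave exactly s in
    \<open>{y..b}\<close>; symmetrically, \<open>inner_y\<close> leaves y in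
    \<open>{a..s}\<close>.\<close>
  have inner_s: "(\<integral>s. H y s \<partial>lebesgue) = indicator {a..b} y *\<^sub>R (P y * (LINT s:{y..b}|lebesgue. k y s * g s))" for y
  proof -
    have "H y s = indicator {a..b} y * P y * (indicator {y..b} s *\<^sub>R (k y s * g s))" for s
      by (auto simp: H_def K_def p_def q_def indicator_def)
    then show ?thesis
      by (simp add: set_lebesgue_integral_def)
  qed
  have inner_y: "(\<integral>y. H y s \<partial>lebesgue) = indicator {a..b} s *\<^sub>R ((LINT y:{a..s}|lebesgue. P y * k y s) * g s)" for s
  proof -
    have "H y s = (indicator {a..s} y *\<^sub>R (P y * k y s)) * (indicator {a..b} s * g s)" for y
      by (auto simp: H_def K_def p_def q_def indicator_def)
    then show ?thesis
      by (simp add: set_lebesgue_integral_def)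
  qed
  show "set_integrable lebesgue {a..b} (\<lambda>y. P y * (LINT s:{y..b}|lebesgue. k y s * g s))"
    using LL.integrable_fst[OF H] by (simp add: inner_s set_integrable_def)
  show "(LINT y:{a..b}|lebesgue. P y * (LINT s:{y..b}|lebesgue. k y s * g s)) =
      (LINT s:{a..b}|lebesgue. (LINT y:{a..s}|lebesgue. P y * k y s) * g s)"
    using LL.Fubini_integral[OF H] by (simp add: inner_s inner_y set_lebesgue_integral_def)
qed

lemma set_integral_sum_mult_left:
  fixes w :: "'i \<Rightarrow> 'a \<Rightarrow> real"
  assumes "\<And>i. i \<in> I \<Longrightarrow> set_integrable M A (w i)"
  shows "(LINT y:A|M. (\<Sum>i\<in>I. w i y * c i)) = (\<Sum>i\<in>I. (LINT y:A|M. w i y) * c i)"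
proof -
  have "(LINT y:A|M. (\<Sum>i\<in>I. w i y * c i)) = (\<integral>y. (\<Sum>i\<in>I. (indicator A y *\<^sub>R w i y) * c i) \<partial>M)"
    by (simp add: set_lebesgue_integral_def sum_distrib_left mult.assoc)
  also have "\<dots> = (\<Sum>i\<in>I. (\<integral>y. (indicator A y *\<^sub>R w i y) * c i \<partial>M))"
    using assms unfolding set_integrable_def
    by (intro Bochner_Integration.integral_sum integrable_mult_left) auto
  finally show ?thesis
    by (simp add: set_lebesgue_integral_def)
qed

text \<open>Supplies the derivative hypothesis \<open>Df\<close> of the Taylor lemma for the
  iterated derivatives.\<close>

lemma C_k_on_has_vector_derivative:
  assumes "C_k_on k S f" "i < k" "x \<in> S"
  shows "(nth_deriv_within S i f has_vector_derivative nth_deriv_within S (Suc i) f x) (at x within S)"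
  using assms
  by (auto simp: C_k_on_def nth_deriv_within_def differentiable_on_def vector_derivative_works)

theorem theorem2p3:
  fixes a b :: real and m :: nat and f P :: "real \<Rightarrow> real"
  assumes "a < b"
    and "C_k_on (m + 1) {a..b} f"
    and "P absolutely_integrable_on {a..b}"
    and "f absolutely_integrable_on {a..b}"
  shows "(LINT y:{a..b}|lebesgue. f y * P y) =
    (\<Sum>i=0..m. (LINT y:{a..b}|lebesgue. P y * ((b - y) ^ i / fact i))
                 * (-1) ^ i * nth_deriv_within {a..b} i f b)
    + (LINT s:{a..b}|lebesgue.
         (LINT y:{a..s}|lebesgue. P y * ((s - y) ^ m / fact m))
           * (-1) ^ (m + 1) * nth_deriv_within {a..b} (m + 1) f s)"
proof -
  define D where "D i = nth_deriv_within {a..b} i f" for i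
  \<comment> \<open>The sign is absorbed into \<open>g\<close>, and likewise into \<open>c\<close>,
    so that the remainder has the shape kernel times \<open>g\<close> required by the triangle
    lemma.\<close>
  define g where "g s = (-1) ^ (m + 1) * D (m + 1) s" for s
  define k where "k y s = (s - y) ^ m / fact m" for y s :: real
  define c where "c i = (-1) ^ i * D i b" for i
  have cont_g: "continuous_on {a..b} g"
    using assms(2) by (auto simp: g_def D_def C_k_on_def intro!: continuous_intros)
  have taylor: "f y = (\<Sum>i=0..m. (b - y) ^ i / fact i * c i) + (LINT s:{y..b}|lebesgue. k y s * g s)"
    if y: "y \<in> {a..b}" for y
  proof -
    have sub: "{y..b} \<subseteq> {a..b}"
      using y by auto
    have "((\<lambda>s. ((s - y) ^ (m + 1 - 1) / fact (m + 1 - 1)) *\<^sub>R ((-1) ^ (m + 1) *\<^sub>R D (m + 1) s)) has_integral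
        f y - (\<Sum>i<m + 1. ((b - y) ^ i / fact i) *\<^sub>R ((-1) ^ i *\<^sub>R D i b))) {y..b}"
    proof (rule Taylor_has_integral_right_endpoint)
      show "D 0 = f"
        by (simp add: D_def nth_deriv_within_def)
      show "(D i has_vector_derivative D (Suc i) t) (at t within {y..b})"
        if "i < m + 1" "y \<le> t" "t \<le> b" for i t
        \<comment> \<open>Derivatives within \<open>{a..b}\<close> remain derivatives within the
          smaller interval \<open>{y..b}\<close>.\<close>
        unfolding D_def
        by (rule has_vector_derivative_within_subset[OF C_k_on_has_vector_derivative sub])
          (use assms(2) that y in auto)
    qed (use y in auto)
    then have "((\<lambda>s. k y s * g s) has_integral f y - (\<Sum>i=0..m. (b - y) ^ i / fact i * c i)) {y..b}"
      by (simp add: k_def g_def c_def atLeast0AtMost lessThan_Suc_atMost)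
    \<comment> \<open>The Taylor lemma gives a gauge integral; absolute integrability identifies it
      with the Lebesgue integral.\<close>
    moreover have "(\<lambda>s. k y s * g s) absolutely_integrable_on {y..b}"
      unfolding k_def
      by (intro absolutely_integrable_continuous_real continuous_intros
          continuous_on_subset[OF cont_g sub]) auto
    ultimately have "(LINT s:{y..b}|lebesgue. k y s * g s) =
        f y - (\<Sum>i=0..m. (b - y) ^ i / fact i * c i)"
      by (metis set_lebesgue_integral_eq_integral(2) integral_unique)
    then show ?thesis
      by simp
  qed
  have "g absolutely_integrable_on {a..b}"
    by (rule absolutely_integrable_continuous_real[OF cont_g])
  moreover have "case_prod k \<in> borel_measurable borel"
    unfolding k_def case_prod_beta
    by (intro borel_measurable_continuous_onI continuous_intros) auto
  \<comment> \<open>On the triangle 0 <= s - y <= b - a, and the power is monotone on nonnegative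
    bases.\<close>
  moreover have "\<bar>k y s\<bar> \<le> (b - a) ^ m / fact m" if "a \<le> y" "y \<le> s" "s \<le> b" for y s
    using that by (auto simp: k_def intro!: divide_right_mono power_mono)
  ultimately have fubini:
    "set_integrable lebesgue {a..b} (\<lambda>y. P y * (LINT s:{y..b}|lebesgue. k y s * g s))"
    "(LINT y:{a..b}|lebesgue. P y * (LINT s:{y..b}|lebesgue. k y s * g s)) =
      (LINT s:{a..b}|lebesgue. (LINT y:{a..s}|lebesgue. P y * k y s) * g s)"
    using set_integral_triangle_swap[OF assms(3), of g k] by blast+
  \<comment> \<open>A continuous weight on a compact interval is bounded and measurable, so its
    product with \<open>P\<close> stays integrable.\<close>
  have poly: "set_integrable lebesgue {a..b} (\<lambda>y. P y * ((b - y) ^ i / fact i))" for i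
  proof -
    have "(\<lambda>y. ((b - y) ^ i / fact i) * P y) absolutely_integrable_on {a..b}"
      by (intro absolutely_integrable_bounded_measurable_product_real assms(3)
          continuous_imp_measurable_on_sets_lebesgue compact_imp_bounded
          compact_continuous_image continuous_intros) auto
    then show ?thesis
      by (simp add: mult.commute)
  qed
  have "(LINT y:{a..b}|lebesgue. f y * P y) =
      (LINT y:{a..b}|lebesgue. (\<Sum>i=0..m. P y * ((b - y) ^ i / fact i) * c i)
        + P y * (LINT s:{y..b}|lebesgue. k y s * g s))"
    by (rule set_lebesgue_integral_cong)
      (use taylor in \<open>auto simp: algebra_simps sum_distrib_left\<close>)
  \<comment> \<open>Additivity needs both summands integrable: \<open>poly\<close> covers the finite
    sum and \<open>fubini(1)\<close> the remainder.\<close>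
  also have "\<dots> = (LINT y:{a..b}|lebesgue. (\<Sum>i=0..m. P y * ((b - y) ^ i / fact i) * c i))
      + (LINT y:{a..b}|lebesgue. P y * (LINT s:{y..b}|lebesgue. k y s * g s))"
    by (intro set_integral_add fubini(1) absolutely_integrable_sum set_integrable_mult_left poly) auto
  also have "(LINT y:{a..b}|lebesgue. (\<Sum>i=0..m. P y * ((b - y) ^ i / fact i) * c i)) =
      (\<Sum>i=0..m. (LINT y:{a..b}|lebesgue. P y * ((b - y) ^ i / fact i)) * c i)"
    by (rule set_integral_sum_mult_left) (rule poly)
  finally show ?thesis
    unfolding fubini(2) by (simp add: c_def g_def k_def D_def mult.assoc)
qed

end
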